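(* Let $c_0>0$ and $c_1\ge 0,\ldots,c_{k-1}\ge 0$ be real numbers, and let $p$, $\rho$, $h>1$, $I$ and $I_m$ ($0\le m<h$) be as defined in the context. Then $$h=\gcd(I\cup\{k\}).$$ Moreover, every sequence $(a_n)_{n\ge 1}$ which satisfies the recurrence relation $$a_{n+k}=c_{k-1}a_{n+k-1}+c_{k-2}a_{n+k-2}+\cdots+c_1a_{n+1}+c_0a_n$$ with non-negative initial conditions $a_1,\ldots,a_k\ge 0$ is the union of the $h$ subsequences $\big((a_{m+hn})_{n\ge 1}\big)_{0\le m<h}$. Finally, for every $0\le m<h$, the following alternative holds: - if $\{j\in I_m : a_j>0\}\neq\emptyset$, then $\lim_{n\to\infty}\frac{a_{m+hn}}{\rho^{n}}$ exists and is (strictly) positive, and the sequence $(a_{m+hn})_{n\ge 1}$ satisfies Benford's law in base $b$ for every $b$ such that $\log_b(\rho)\notin\mathbb{Q}$; - if $\{j\in I_m : a_j>0\}=\emptyset$, then $a_{m+hn}=0$ for all $n\ge 1$.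
   Context: Let $k$ be a positive integer, and let $$p(x)=x^k-c_{k-1}x^{k-1}-\cdots-c_1x-c_0$$ be the characteristic polynomial of the recurrence relation, where $c_0>0$ and $c_1,\ldots,c_{k-1}\ge 0$. Such a polynomial always has a dominant root $\rho>0$, that is, a positive root such that $|\zeta|\le\rho$ for every other complex root $\zeta$ of $p$. The case considered is the one where $p$ has $h>1$ roots $\zeta_1=\rho,\ldots,\zeta_h$ with $|\zeta_j|=\rho$; $h$ denotes the number of roots of modulus $\rho$. Put $I=\{1\le j<k : c_j>0\}$ and, for every $m\in\{0,\ldots,h-1\}$, $$I_m=\{j\in I : j\equiv m \pmod h\},$$ so that $(I_m)_{0\le m<h}$ is a partition of $I$. For an integer $b>2$ and a real number $u>0$, the mantissa $M_b(u)$ is the unique element of $[1,b)$ such that $u=M_b(u)\cdot b^r$ with $r\in\mathbb{Z}$. A sequence $(u_n)_{n\ge 1}$ of strictly positive real numbers satisfies Benford's law in base $b$ (where $b>2$ is an integer) if for every $t\in[1,b)$, $$\lim_{N\to\infty}\frac{|\{1\le n\le N : M_b(u_n)<t\}|}{N}=\log_b(t).$$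
   Formalization: Corrected: in the alternative I_m becomes {1≤j≤k: j≡m mod h}; the limit is of a_{m+hn}/ρ^{hn}; Benford asks positivity only from some term on; the union holds with n≥0 (indices ≥1), or with n≥1 for indices ≥h only. As printed, p=x²−4, a_1=a_2=1 is a counterexample. *)

theory Defs
  imports Complex_Main "HOL-Computational_Algebra.Polynomial" "HOL-Library.Disjoint_Sets"
begin

definition char_poly :: "nat \<Rightarrow> (nat \<Rightarrow> real) \<Rightarrow> real poly" where
  "char_poly k c = monom 1 k - (\<Sum>j<k. monom (c j) j)"

definition complex_roots :: "real poly \<Rightarrow> complex set" where
  "complex_roots p = {z. poly (map_poly complex_of_real p) z = 0}"

definition is_dominant_root :: "real poly \<Rightarrow> real \<Rightarrow> bool" where
  "is_dominant_root p \<rho> \<longleftrightarrow>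
     \<rho> > 0 \<and> poly p \<rho> = 0 \<and> (\<forall>z \<in> complex_roots p. cmod z \<le> \<rho>)"

definition num_roots_of_modulus :: "real poly \<Rightarrow> real \<Rightarrow> nat" where
  "num_roots_of_modulus p \<rho> = card {z \<in> complex_roots p. cmod z = \<rho>}"

definition coeff_support :: "nat \<Rightarrow> (nat \<Rightarrow> real) \<Rightarrow> nat set" where
  "coeff_support k c = {j. 1 \<le> j \<and> j < k \<and> c j > 0}"

(* The alternative for a_(m + h n) depends on the initial values a_j, j = m (mod h), so
   it is stated with S = {1..k}.  Taking S = coeff_support k c would make it false: all
   indices in coeff_support are multiples of h, so its part for 0 < m < h is empty. *)
definition residue_part :: "nat set \<Rightarrow> nat \<Rightarrow> nat \<Rightarrow> nat set" where
  "residue_part S h m = {j \<in> S. j mod h = m mod h}"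

(* Sequences are indexed from 1; the value a 0 is irrelevant. *)
definition satisfies_recurrence :: "nat \<Rightarrow> (nat \<Rightarrow> real) \<Rightarrow> (nat \<Rightarrow> real) \<Rightarrow> bool" where
  "satisfies_recurrence k c a \<longleftrightarrow> (\<forall>n\<ge>1. a (n + k) = (\<Sum>j<k. c j * a (n + j)))"

(* The sequence (a i), i in D, is the disjoint union, indices included, of the
   subsequences (a (s m n)), n in E m, for m in M. *)
definition is_union_of_subseqs ::
  "(nat \<Rightarrow> real) \<Rightarrow> nat set \<Rightarrow> nat set \<Rightarrow> (nat \<Rightarrow> nat set) \<Rightarrow> (nat \<Rightarrow> nat \<Rightarrow> nat) \<Rightarrow> bool" where
  "is_union_of_subseqs a D M E s \<longleftrightarrow>
     (\<forall>m\<in>M. strict_mono_on (E m) (s m)) \<and>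
     disjoint_family_on (\<lambda>m. s m ` E m) M \<and>
     (\<lambda>i. (i, a i)) ` D = (\<Union>m\<in>M. (\<lambda>n. (s m n, a (s m n))) ` E m)"

definition mantissa :: "nat \<Rightarrow> real \<Rightarrow> real" where
  "mantissa b u = (THE x. 1 \<le> x \<and> x < real b \<and> (\<exists>r::int. u = x * real b powi r))"

(* Positivity is only required from some index on: finitely many terms do not affect
   the limit, and a sequence satisfying the recurrence may have zeros among its
   initial terms. *)
definition benford :: "nat \<Rightarrow> (nat \<Rightarrow> real) \<Rightarrow> bool" where
  "benford b u \<longleftrightarrow>
     (\<forall>\<^sub>F n in sequentially. u n > 0) \<and>
     (\<forall>t. 1 \<le> t \<and> t < real b \<longrightarrow>
        (\<lambda>N. real (card {n. 1 \<le> n \<and> n \<le> N \<and> mantissa b (u n) < t}) / real N)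
          \<longlonglongrightarrow> log (real b) t)"

end

(* Dividing the equation for a root of modulus rho by rho^k exhibits the unit number w^k as a
   convex combination of powers w^j; equality in the triangle inequality forces w^g = 1 with
   g = gcd(I, k), hence h = g. Along a residue class mod h, the sequence scaled by powers of rho
   therefore satisfies a recurrence with convex weights whose support has gcd 1: each value
   bounds, up to a constant factor, all values of a later window, so the oscillation over
   windows contracts and the limit exists; it is positive once one initial value is positive.
   Consequently log_b of the subsequence is n * alpha + constant + o(1) with alpha irrational,
   and Benford's law becomes Weyl equidistribution. The latter needs only upper bounds for
   visits to arcs: if q * alpha is within a small delta of an integer, translating an arc of
   length |delta| by q-step shifts gives about 1/|delta| disjoint arcs visited equally often. *)

theory Submission
  imports Defs "HOL-Analysis.Kronecker_Approximation_Theorem"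
begin

section \<open>Aperiodic convex recurrences\<close>

text \<open>The least positive difference \<open>d\<close> between elements \<open>p\<close> and
  \<open>p + d\<close> of \<open>A\<close> divides every element, because a nonzero remainder would
  be a smaller difference. Hence \<open>d = 1\<close>, and \<open>p\<close>, \<open>p + 1\<close>
  generate everything from \<open>p * p\<close> on.\<close>

lemma add_closed_contains_tail:
  fixes A :: "nat set"
  assumes zero: "0 \<in> A"
    and add: "\<And>x y. x \<in> A \<Longrightarrow> y \<in> A \<Longrightarrow> x + y \<in> A"
    and gcd1: "\<And>d. (\<And>x. x \<in> A \<Longrightarrow> d dvd x) \<Longrightarrow> d = 1"
  shows "\<exists>T. \<forall>n\<ge>T. n \<in> A"
proof -
  have mult: "q * x \<in> A" if "x \<in> A" for q x
    by (induction q) (auto simp: zero add that)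
  define P where "P d \<longleftrightarrow> d > 0 \<and> (\<exists>x. x \<in> A \<and> x + d \<in> A)" for d
  have "\<exists>x\<in>A. x > 0"
    using gcd1[of 0] by (metis dvd_0_right gr0I zero_neq_one)
  then obtain x0 where "x0 \<in> A" "x0 > 0" by blast
  then have "P x0" by (auto simp: P_def intro!: exI[of _ 0] zero)
  define d where "d = (LEAST d. P d)"
  have "P d" unfolding d_def by (rule LeastI) fact
  then obtain p where p: "d > 0" "p \<in> A" "p + d \<in> A" by (auto simp: P_def)
  have "d dvd x" if "x \<in> A" for x
  proof (rule ccontr)
    assume "\<not> d dvd x"
    then have r: "x mod d > 0" by (simp add: mod_greater_zero_iff_not_dvd)
    \<comment> \<open>Both \<open>x div d * (p + d)\<close> and \<open>x + x div d * p\<close> lie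
      in \<open>A\<close>, and they differ by \<open>x mod d\<close>.\<close>
    have "x div d * (p + d) + x mod d = x + x div d * p"
      by (simp add: algebra_simps)
    then have "P (x mod d)"
      unfolding P_def using r mult[OF p(3)] add[OF that mult[OF p(2)]] by metis
    then have "d \<le> x mod d" unfolding d_def by (rule Least_le)
    then show False using p(1) mod_less_divisor[of d x] by linarith
  qed
  then have "d = 1" by (rule gcd1)
  have "n \<in> A" if "n \<ge> p * p" for n
  proof (cases "p = 0")
    case True
    then show ?thesis using p mult[of 1 n] \<open>d = 1\<close> by simp
  next
    case False
    \<comment> \<open>There are enough copies of \<open>p\<close> in \<open>n\<close> to absorb the
      remainder by replacing \<open>n mod p\<close> of them with \<open>p + 1\<close>.\<close>
    have "n mod p \<le> n div p"
    proof -
      have "n mod p < p" using False by simp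
      moreover have "p \<le> n div p"
        using that False by (simp add: less_eq_div_iff_mult_less_eq)
      ultimately show ?thesis by simp
    qed
    then obtain e where e: "n div p = n mod p + e" using le_Suc_ex by blast
    have "n = n div p * p + n mod p" by simp
    also have "\<dots> = e * p + n mod p * (p + 1)"
      unfolding e by (simp add: algebra_simps)
    finally show ?thesis
      using add[OF mult[OF p(2)] mult[OF p(3)]] \<open>d = 1\<close> by metis
  qed
  then show ?thesis by blast
qed

text \<open>This is the recurrence along one residue class modulo h after scaling by powers of
  \<rho>; \<open>K\<close> is then k / h. The condition \<open>aperiodic\<close> says that
  \<open>K\<close> and the indices of positive weights have gcd 1.\<close>

locale convex_recurrence =
  fixes K :: nat and d :: "nat \<Rightarrow> real"
  assumes K_pos: "K \<ge> 1"
    and d0: "d 0 > 0"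
    and d_nonneg: "\<And>i. i < K \<Longrightarrow> d i \<ge> 0"
    and d_sum: "(\<Sum>i<K. d i) = 1"
    and aperiodic: "\<And>e. e dvd K \<Longrightarrow> (\<And>i. i < K \<Longrightarrow> d i > 0 \<Longrightarrow> e dvd i) \<Longrightarrow> e = 1"
begin

definition solution :: "(nat \<Rightarrow> real) \<Rightarrow> bool" where
  "solution x \<longleftrightarrow> (\<forall>n. x (n + K) = (\<Sum>i<K. d i * x (n + i)))"

lemma solution_shift: "solution x \<Longrightarrow> solution (\<lambda>n. x (m + n))"
  by (simp add: solution_def flip: add.assoc)

text \<open>Constants are solutions because the weights sum to 1. This allows a window minimum to be
  subtracted, which leaves a nonnegative solution.\<close>

lemma solution_diff_const: "solution x \<Longrightarrow> solution (\<lambda>n. x n - C)"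
  by (simp add: solution_def right_diff_distrib sum_subtractf d_sum flip: sum_distrib_right)

lemma solution_uminus: "solution x \<Longrightarrow> solution (\<lambda>n. - x n)"
  by (simp add: solution_def sum_negf)

text \<open>Each new value is a convex combination of the preceding \<open>K\<close> values. Upper
  bounds follow by applying this to the negated solution.\<close>

lemma solution_lower_bound:
  assumes "solution x" and "\<And>i. i < K \<Longrightarrow> m \<le> x i"
  shows "m \<le> x n"
proof (induction n rule: less_induct)
  case (less n)
  show ?case
  proof (cases "n < K")
    case False
    then obtain p where p: "n = p + K" by (metis add.commute le_Suc_ex not_less)
    have "m = (\<Sum>i<K. d i * m)" by (simp add: d_sum flip: sum_distrib_right)
    also have "\<dots> \<le> (\<Sum>i<K. d i * x (p + i))"
      by (intro sum_mono mult_left_mono less d_nonneg) (auto simp: p)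
    also have "\<dots> = x n" using assms(1) by (simp add: solution_def p)
    finally show ?thesis .
  qed (simp add: assms)
qed

lemma solution_step:
  assumes "solution y" "\<And>n. y n \<ge> 0" "i < K"
  shows "d i * y (n + i) \<le> y (n + K)"
proof -
  have "d i * y (n + i) \<le> (\<Sum>i<K. d i * y (n + i))"
    using assms(3) by (intro member_le_sum) (auto intro: mult_nonneg_nonneg d_nonneg assms(2))
  then show ?thesis using assms(1) by (simp add: solution_def)
qed

text \<open>Starting at index \<open>K\<close>, a step by \<open>K - i\<close> costs only a factor \<open>d i\<close>; these steps generate
  a numerical semigroup that contains all large integers.\<close>

lemma solution_spread:
  "\<exists>\<beta>>0. \<exists>R. \<forall>y. solution y \<and> (\<forall>n. y n \<ge> 0) \<longrightarrow> (\<forall>i<K. \<forall>j<K. \<beta> * y j \<le> y (R + i))"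
proof -
  define B where "B t \<beta> \<longleftrightarrow> \<beta> > 0 \<and>
    (\<forall>y. solution y \<and> (\<forall>n. y n \<ge> 0) \<longrightarrow> (\<forall>n. \<beta> * y (n + K) \<le> y (n + K + t)))" for t \<beta>
  define A where "A = {t. \<exists>\<beta>. B t \<beta>}"
  have step: "K - i \<in> A" if "i < K" "d i > 0" for i
  proof -
    have "d i * y (n + K) \<le> y (n + K + (K - i))" if "solution y" "\<forall>n. y n \<ge> 0" for y n
      using solution_step[of y i "n + (K - i)"] that \<open>i < K\<close> by (simp add: algebra_simps)
    then show ?thesis using that unfolding A_def B_def by blast
  qed
  have "\<exists>T. \<forall>n\<ge>T. n \<in> A"
  proof (rule add_closed_contains_tail)
    show "0 \<in> A" by (auto simp: A_def B_def intro!: exI[of _ 1])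
  next
    fix s t assume "s \<in> A" "t \<in> A"
    then obtain \<beta> \<gamma> where b: "B s \<beta>" and g: "B t \<gamma>" by (auto simp: A_def)
    have "\<gamma> * \<beta> * y (n + K) \<le> y (n + K + (s + t))"
      if y: "solution y" "\<forall>n. y n \<ge> 0" for y n
    proof -
      have "\<gamma> * \<beta> * y (n + K) = \<gamma> * (\<beta> * y (n + K))" by simp
      also have "\<dots> \<le> \<gamma> * y (n + s + K)"
      proof (rule mult_left_mono)
        have "\<beta> * y (n + K) \<le> y (n + K + s)" using b y unfolding B_def by blast
        then show "\<beta> * y (n + K) \<le> y (n + s + K)" by (simp add: ac_simps)
      qed (use g in \<open>auto simp: B_def\<close>)
      also have "\<dots> \<le> y (n + s + K + t)" using g y unfolding B_def by blast
      finally show ?thesis by (simp add: ac_simps)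
    qed
    moreover have "\<gamma> * \<beta> > 0" using b g by (auto simp: B_def)
    ultimately show "s + t \<in> A" unfolding A_def B_def by blast
  next
    fix e assume e: "\<And>x. x \<in> A \<Longrightarrow> e dvd x"
    show "e = 1"
    proof (rule aperiodic)
      \<comment> \<open>The step for \<open>i = 0\<close> has length \<open>K\<close>; from
        \<open>e dvd K\<close> and \<open>e dvd K - i\<close> one recovers
        \<open>e dvd i\<close>.\<close>
      show K': "e dvd K" using e[OF step[of 0]] K_pos d0 by auto
      fix i assume "i < K" "d i > 0"
      then show "e dvd i"
        using e[OF step[of i]] K' by (metis dvd_diff_nat diff_diff_cancel less_imp_le)
    qed
  qed
  then obtain T where T: "\<And>n. n \<ge> T \<Longrightarrow> n \<in> A" by blast
  then have "\<forall>n. n \<ge> T \<longrightarrow> (\<exists>\<beta>. B n \<beta>)" by (auto simp: A_def)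
  then obtain f where f: "\<And>n. n \<ge> T \<Longrightarrow> B n (f n)" by metis
  \<comment> \<open>A single factor has to serve all gaps that occur below, and these lie in a
    finite range.\<close>
  define \<beta> where "\<beta> = Min (f ` {T..T + 2 * K})"
  have "\<beta> > 0" using f by (auto simp: \<beta>_def B_def)
  have "\<beta> * d 0 * y j \<le> y (T + 2 * K + i)"
    if y: "solution y" "\<And>n. y n \<ge> 0" and ij: "i < K" "j < K" for y i j
  proof -
    \<comment> \<open>Moving from \<open>j\<close> to \<open>j + K\<close> costs the factor
      \<open>d 0\<close>. The remaining gap up to \<open>T + 2 * K + i\<close> is \<open>t\<close>,
      which is at least \<open>T\<close> and at most \<open>T + 2 * K\<close> because
      \<open>i\<close> and \<open>j\<close> are below \<open>K\<close>.\<close>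
    define t where "t = T + K + i - j"
    have t: "t \<in> {T..T + 2 * K}" "j + K + t = T + 2 * K + i" using ij by (auto simp: t_def)
    have "\<beta> * d 0 * y j = \<beta> * (d 0 * y j)" by simp
    also have "\<dots> \<le> \<beta> * y (j + K)"
      using solution_step[OF y, of 0 j] \<open>\<beta> > 0\<close> K_pos by (intro mult_left_mono) auto
    also have "\<dots> \<le> f t * y (j + K)"
      unfolding \<beta>_def using t y(2) by (intro mult_right_mono Min_le) auto
    also have "\<dots> \<le> y (j + K + t)" using f[of t] t(1) y by (auto simp: B_def)
    finally show "\<beta> * d 0 * y j \<le> y (T + 2 * K + i)" by (simp add: t(2))
  qed
  moreover have "\<beta> * d 0 > 0" using d0 \<open>\<beta> > 0\<close> by simp
  ultimately show ?thesis by blast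
qed

text \<open>The window minimum increases, the window maximum decreases, and \<open>solution_spread\<close>
  forces their limits to agree.\<close>

lemma solution_convergent:
  assumes x: "solution x"
  shows "convergent x"
proof -
  obtain \<beta> R where \<beta>: "\<beta> > 0"
    and spread: "\<And>y i j. solution y \<Longrightarrow> \<forall>n. y n \<ge> 0 \<Longrightarrow> i < K \<Longrightarrow> j < K \<Longrightarrow> \<beta> * y j \<le> y (R + i)"
    using solution_spread by meson
  define lo where "lo n = Min ((\<lambda>i. x (n + i)) ` {..<K})" for n
  define hi where "hi n = Max ((\<lambda>i. x (n + i)) ` {..<K})" for n
  have ne: "{..<K} \<noteq> {}" using K_pos by (auto simp: lessThan_empty_iff)
  have lo: "lo n \<le> x (n + i)" for n i
    by (rule solution_lower_bound[OF solution_shift[OF x]]) (auto simp: lo_def)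
  have "- hi n \<le> - x (n + i)" for n i
    by (rule solution_lower_bound[OF solution_uminus[OF solution_shift[OF x]]]) (auto simp: hi_def)
  then have hi: "x (n + i) \<le> hi n" for n i by simp
  have "lo n \<le> lo (Suc n)" for n
    unfolding lo_def[of "Suc n"] using ne lo[of n "Suc _"] by auto
  then have inc: "incseq lo" by (rule incseq_SucI)
  have "hi (Suc n) \<le> hi n" for n
    unfolding hi_def[of "Suc n"] using ne hi[of n "Suc _"] by auto
  then have dec: "decseq hi" by (rule decseq_SucI)
  have lohi: "lo n \<le> hi n" for n using lo[of n 0] hi[of n 0] by simp
  have "lo n \<le> hi 0" for n using lo[of n 0] hi[of 0 n] by simp
  then obtain l where l: "lo \<longlonglongrightarrow> l" using incseq_convergent[OF inc] by metis
  have "lo 0 \<le> hi n" for n using lo[of 0 n] hi[of n 0] by simp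
  then obtain u where u: "hi \<longlonglongrightarrow> u" using decseq_convergent[OF dec] by metis
  \<comment> \<open>After subtraction of \<open>lo n\<close> the solution is nonnegative, and its
    value \<open>hi n - lo n\<close> at the position of the maximum lifts the whole window starting
    at \<open>n + R\<close>.\<close>
  have gap: "lo n + \<beta> * (hi n - lo n) \<le> lo (n + R)" for n
  proof -
    have "hi n \<in> (\<lambda>i. x (n + i)) ` {..<K}" unfolding hi_def using ne by (intro Max_in) auto
    then obtain j where j: "j < K" "hi n = x (n + j)" by auto
    have "solution (\<lambda>i. x (n + i) - lo n)"
      by (rule solution_diff_const[OF solution_shift[OF x]])
    moreover have "\<forall>i. x (n + i) - lo n \<ge> 0" using lo by simp
    ultimately have "\<beta> * (x (n + j) - lo n) \<le> x (n + (R + i)) - lo n" if "i < K" for i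
      using spread that j(1) by blast
    then show ?thesis
      unfolding lo_def[of "n + R"] using ne by (force simp: j(2) add.assoc)
  qed
  have "(\<lambda>n. lo n + \<beta> * (hi n - lo n)) \<longlonglongrightarrow> l + \<beta> * (u - l)"
    by (intro tendsto_intros l u)
  \<comment> \<open>Passing to the limit in \<open>gap\<close> leaves no room for a positive
    oscillation \<open>u - l\<close>.\<close>
  then have "l + \<beta> * (u - l) \<le> l"
    using LIMSEQ_le[OF _ LIMSEQ_ignore_initial_segment[OF l, of R]] gap by blast
  moreover have "l \<le> u" using LIMSEQ_le[OF l u] lohi by blast
  ultimately have "u = l" using \<beta> by (auto simp: mult_le_0_iff)
  have "x \<longlonglongrightarrow> l"
    by (rule tendsto_sandwich[OF _ _ l]) (use lo[of _ 0] hi[of _ 0] u \<open>u = l\<close> in auto)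
  then show ?thesis by (rule convergentI)
qed

text \<open>One positive initial value bounds a whole later window from below, and this bound then
  persists to the limit.\<close>

lemma solution_tendsto_positive:
  assumes x: "solution x" and nonneg: "\<And>i. i < K \<Longrightarrow> x i \<ge> 0" and j: "j < K" "x j > 0"
  shows "\<exists>L>0. x \<longlonglongrightarrow> L"
proof -
  obtain \<beta> R where \<beta>: "\<beta> > 0"
    and spread: "\<And>y i j. solution y \<Longrightarrow> \<forall>n. y n \<ge> 0 \<Longrightarrow> i < K \<Longrightarrow> j < K \<Longrightarrow> \<beta> * y j \<le> y (R + i)"
    using solution_spread by meson
  have "\<forall>n. x n \<ge> 0" using solution_lower_bound[OF x nonneg] by blast
  then have "\<beta> * x j \<le> x (R + n)" for n
    using solution_lower_bound[OF solution_shift[OF x]] spread[OF x _ _ j(1)] by blast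
  moreover obtain L where L: "x \<longlonglongrightarrow> L" using solution_convergent[OF x] by (auto simp: convergent_def)
  ultimately have "\<beta> * x j \<le> L"
    by (intro LIMSEQ_le_const[OF LIMSEQ_ignore_initial_segment[OF L, of R]]) (auto simp: add.commute)
  moreover have "\<beta> * x j > 0" using \<beta> j by simp
  ultimately show ?thesis using L by (meson less_le_trans)
qed

end

section \<open>Equidistribution of irrational rotations\<close>

text \<open>Reduction modulo 1 is expressed by an integer shift instead of \<open>frac\<close>, so
  arcs may cross integers and be translated freely.\<close>

definition arc_visits :: "(nat \<Rightarrow> real) \<Rightarrow> real \<Rightarrow> real \<Rightarrow> nat \<Rightarrow> nat set" where
  "arc_visits x s l N = {n. n < N \<and> (\<exists>z::int. s \<le> x n - of_int z \<and> x n - of_int z < s + l)}"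

lemma finite_arc_visits [simp]: "finite (arc_visits x s l N)"
  unfolding arc_visits_def by (rule finite_subset[of _ "{..<N}"]) auto

text \<open>The absolute value of \<open>t * \<delta>\<close> lies between \<eta> and 1 - \<eta>, so
  \<open>t * \<delta>\<close> is at distance at least \<eta> from every integer. This makes the
  translated arcs disjoint modulo 1.\<close>

lemma int_shift_separation:
  fixes \<delta> \<eta> t v :: real and w :: int
  assumes \<delta>: "\<bar>\<delta>\<bar> = \<eta>" and t: "1 \<le> t" "(t + 1) * \<eta> \<le> 1" and v: "v = t * \<delta> - of_int w" "\<bar>v\<bar> < \<eta>"
  shows False
proof -
  have t\<eta>: "\<eta> \<le> t * \<eta>" "t * \<eta> \<le> 1 - \<eta>"
    using t \<delta> mult_right_mono[of 1 t \<eta>] by (auto simp: algebra_simps)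
  have "\<bar>t * \<delta>\<bar> = t * \<eta>" using t \<delta> by (simp add: abs_mult)
  then have b: "\<bar>of_int w :: real\<bar> < 1" "t * \<delta> = t * \<eta> \<or> t * \<delta> = - (t * \<eta>)"
    using v t\<eta> by linarith+
  then have "w = 0" by linarith
  then show False using v t\<eta> b by auto
qed

text \<open>The \<open>M\<close> translates of the arc by multiples of \<open>\<delta>\<close> are disjoint modulo 1, and the
  translate by \<open>i\<close> is visited \<open>i * q\<close> steps later; so all their visits fit into
  \<open>{..<N + M * q}\<close>.\<close>

lemma card_small_arc_visits:
  fixes \<theta> \<alpha> \<delta> :: real and p :: int
  assumes q: "real q * \<alpha> = of_int p + \<delta>" and M: "real M * \<bar>\<delta>\<bar> \<le> 1"
  shows "M * card (arc_visits (\<lambda>n. \<theta> + real n * \<alpha>) s \<bar>\<delta>\<bar> N) \<le> N + M * q"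
proof -
  define C where "C = arc_visits (\<lambda>n. \<theta> + real n * \<alpha>) s \<bar>\<delta>\<bar> N"
  define f where "f = (\<lambda>(n, i). n + i * q)"
  \<comment> \<open>A collision would give two points of one arc that differ by
    \<open>t * \<delta>\<close> modulo 1, where \<open>t = i' - i\<close> is positive and below
    \<open>M\<close>.\<close>
  have no: False if nC: "n \<in> C" "n' \<in> C" and that: "i < i'" "i' < M" "n + i * q = n' + i' * q" for n n' i i'
  proof -
    obtain z z' :: int where z: "s \<le> \<theta> + real n * \<alpha> - z" "\<theta> + real n * \<alpha> - z < s + \<bar>\<delta>\<bar>"
      "s \<le> \<theta> + real n' * \<alpha> - z'" "\<theta> + real n' * \<alpha> - z' < s + \<bar>\<delta>\<bar>"
      using nC by (auto simp: C_def arc_visits_def)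
    define t where "t = i' - i"
    have n: "n = n' + t * q" using that by (simp add: t_def algebra_simps)
    have "real n * \<alpha> = real n' * \<alpha> + real t * (real q * \<alpha>)" by (simp add: n algebra_simps)
    also have "\<dots> = real n' * \<alpha> + real t * (of_int p + \<delta>)" unfolding q ..
    finally have "real n * \<alpha> = real n' * \<alpha> + real t * (of_int p + \<delta>)" .
    then have e: "(\<theta> + real n * \<alpha> - z) - (\<theta> + real n' * \<alpha> - z') = real t * \<delta> - of_int (z - z' - int t * p)"
      by (simp add: algebra_simps)
    have t1: "1 \<le> t" "t + 1 \<le> M" using that by (auto simp: t_def)
    then have "(real t + 1) * \<bar>\<delta>\<bar> \<le> real M * \<bar>\<delta>\<bar>" by (intro mult_right_mono) auto
    then have t: "1 \<le> real t" "(real t + 1) * \<bar>\<delta>\<bar> \<le> 1" using M t1 by auto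
    show False
      by (rule int_shift_separation[OF refl t e]) (use z in linarith)
  qed
  have "inj_on f (C \<times> {..<M})"
  proof (rule inj_onI)
    fix u v assume uv: "u \<in> C \<times> {..<M}" "v \<in> C \<times> {..<M}" "f u = f v"
    then show "u = v"
      using no[of "fst u" "fst v" "snd u" "snd v"] no[of "fst v" "fst u" "snd v" "snd u"]
      by (cases "snd u" "snd v" rule: linorder_cases) (auto simp: f_def split: prod.splits)
  qed
  moreover have "f ` (C \<times> {..<M}) \<subseteq> {..<N + M * q}"
  proof -
    have "n + i * q < N + M * q" if "n \<in> C" "i < M" for n i
      using that by (intro add_less_le_mono mult_right_mono) (auto simp: C_def arc_visits_def)
    then show ?thesis by (auto simp: f_def)
  qed
  ultimately have "card (C \<times> {..<M}) \<le> card {..<N + M * q}"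
    by (intro card_inj_on_le) auto
  then show ?thesis by (simp add: C_def card_cartesian_product mult.commute)
qed

text \<open>An arc of length \<open>l\<close> is covered by at most \<open>l / \<eta> + 1\<close>
  consecutive arcs of length \<eta>.\<close>

lemma card_arc_visits_le_mult:
  assumes "\<eta> > 0" and "\<And>s. real (card (arc_visits x s \<eta> N)) \<le> B" and "l \<ge> 0"
  shows "real (card (arc_visits x s l N)) \<le> (l / \<eta> + 1) * B"
proof -
  define K where "K = nat \<lceil>l / \<eta>\<rceil>"
  have K: "l / \<eta> \<le> real K" "real K \<le> l / \<eta> + 1"
    using assms by (auto simp: K_def)
  have "arc_visits x s l N \<subseteq> (\<Union>i<K. arc_visits x (s + real i * \<eta>) \<eta> N)"
  proof
    fix n assume "n \<in> arc_visits x s l N"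
    then obtain z :: int where z: "n < N" "s \<le> x n - of_int z" "x n - of_int z < s + l"
      by (auto simp: arc_visits_def)
    define v where "v = (x n - of_int z - s) / \<eta>"
    define i where "i = nat \<lfloor>v\<rfloor>"
    have v: "0 \<le> v" "v < l / \<eta>" using z assms by (auto simp: v_def divide_strict_right_mono)
    have iv: "real i \<le> v" "v < real i + 1" using v by (auto simp: i_def)
    have "real i < real K" using iv v K by linarith
    moreover have "x n - of_int z = s + v * \<eta>" using assms by (simp add: v_def)
    moreover have "real i * \<eta> \<le> v * \<eta>" "v * \<eta> < (real i + 1) * \<eta>"
      using iv assms by (auto intro: mult_right_mono mult_strict_right_mono)
    ultimately show "n \<in> (\<Union>i<K. arc_visits x (s + real i * \<eta>) \<eta> N)"
      using z(1) by (auto simp: arc_visits_def algebra_simps intro!: bexI[of _ i] exI[of _ z])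
  qed
  then have "card (arc_visits x s l N) \<le> card (\<Union>i<K. arc_visits x (s + real i * \<eta>) \<eta> N)"
    by (intro card_mono) auto
  also have "\<dots> \<le> (\<Sum>i<K. card (arc_visits x (s + real i * \<eta>) \<eta> N))"
    by (intro card_UN_le) auto
  finally have "real (card (arc_visits x s l N)) \<le> (\<Sum>i<K. real (card (arc_visits x (s + real i * \<eta>) \<eta> N)))"
    by (metis of_nat_le_iff of_nat_sum)
  also have "\<dots> \<le> (\<Sum>i<K. B)" by (intro sum_mono assms)
  \<comment> \<open>\<open>B\<close> is nonnegative because it bounds a cardinality.\<close>
  also have "\<dots> \<le> (l / \<eta> + 1) * B"
    using K assms(2)[of s] by (auto intro!: mult_right_mono)
  finally show ?thesis .
qed

text \<open>Dirichlet approximation provides a small \<eta>, which is nonzero by irrationality. Arcs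
  of length \<eta> receive at most \<open>N / M + q\<close> visits, where \<open>M\<close> is about
  1 / \<eta>, and covering by them loses only a factor close to 1.\<close>

lemma card_arc_visits_upper:
  fixes \<alpha> :: real
  assumes \<alpha>: "\<alpha> \<notin> \<rat>" and l: "l \<ge> 0" and \<epsilon>: "\<epsilon> > 0"
  obtains C where "\<And>N. real (card (arc_visits (\<lambda>n. \<theta> + real n * \<alpha>) s l N)) \<le> (l + \<epsilon>) * real N + C"
proof -
  \<comment> \<open>For \<eta> below \<open>e\<close>, the second bound gives
    \<open>l + \<eta> \<le> (l + \<epsilon>) * (1 - \<eta>)\<close>, and the bound 1/2 keeps
    \<open>1 - \<eta>\<close> positive, so that \<open>M\<close> is positive.\<close>
  define e where "e = min (1/2) (\<epsilon> / (1 + l + \<epsilon>))"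
  have e: "e > 0" "e \<le> 1/2" "e * (1 + l + \<epsilon>) \<le> \<epsilon>"
  proof -
    show "e * (1 + l + \<epsilon>) \<le> \<epsilon>"
      using l \<epsilon> mult_right_mono[of e "\<epsilon> / (1 + l + \<epsilon>)" "1 + l + \<epsilon>"] by (auto simp: e_def)
    show "e \<le> 1/2" unfolding e_def by (rule min.cobounded1)
  qed (use l \<epsilon> in \<open>auto simp: e_def\<close>)
  obtain D where D: "D > 0" "1 / real D < e"
    using e(1) by (metis inverse_eq_divide real_arch_inverse gr0I)
  obtain p :: int and q' :: int where pq: "0 < q'" "\<bar>of_int q' * \<alpha> - of_int p\<bar> < 1 / real D"
    using Dirichlet_approx[OF D(1)] by metis
  define q where "q = nat q'"
  define \<delta> where "\<delta> = real q * \<alpha> - of_int p"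
  define \<eta> where "\<eta> = \<bar>\<delta>\<bar>"
  define M where "M = nat \<lfloor>1 / \<eta>\<rfloor>"
  have q: "real q = of_int q'" "q > 0" using pq by (auto simp: q_def)
  have "\<delta> \<noteq> 0"
  proof
    assume "\<delta> = 0"
    then have "\<alpha> = of_int p / real q" using q by (auto simp: \<delta>_def field_simps)
    then show False using \<alpha> by auto
  qed
  then have \<eta>: "0 < \<eta>" "\<eta> < e" using pq q D by (auto simp: \<eta>_def \<delta>_def)
  have "0 \<le> \<lfloor>1 / \<eta>\<rfloor>" using \<eta> by simp
  then have M': "real M \<le> 1 / \<eta>" "1 / \<eta> < real M + 1" unfolding M_def by simp_all
  then have M: "real M * \<eta> \<le> 1" "1 - \<eta> \<le> real M * \<eta>" using \<eta> by (auto simp: field_simps)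
  then have "real M * \<eta> > 0" using \<eta> e by linarith
  then have Mpos: "real M > 0" using \<eta> by (simp add: zero_less_mult_iff)
  have "real (card (arc_visits (\<lambda>n. \<theta> + real n * \<alpha>) s l N)) \<le> (l + \<epsilon>) * real N + (l / \<eta> + 1) * q" for N
  proof -
    have small: "real (card (arc_visits (\<lambda>n. \<theta> + real n * \<alpha>) s \<eta> N)) \<le> real N / real M + real q" for s
    proof -
      have "M * card (arc_visits (\<lambda>n. \<theta> + real n * \<alpha>) s \<eta> N) \<le> N + M * q"
        unfolding \<eta>_def using M by (intro card_small_arc_visits[where p = p]) (auto simp: \<delta>_def \<eta>_def)
      then have "real M * real (card (arc_visits (\<lambda>n. \<theta> + real n * \<alpha>) s \<eta> N)) \<le> real N + real M * real q"
        by (simp flip: of_nat_mult of_nat_add)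
      then show ?thesis using Mpos by (simp add: field_simps)
    qed
    have "(l / \<eta> + 1) * (1 / real M) \<le> l + \<epsilon>"
    proof -
      have "l + \<eta> \<le> (l + \<epsilon>) * (1 - \<eta>)"
        using e(3) \<eta> l \<epsilon> mult_right_mono[of \<eta> e "1 + l + \<epsilon>"] by (simp add: algebra_simps)
      also have "\<dots> \<le> (l + \<epsilon>) * (real M * \<eta>)" using M l \<epsilon> by (intro mult_left_mono) auto
      finally show ?thesis using Mpos \<eta> by (simp add: field_simps)
    qed
    then have "(l / \<eta> + 1) * (1 / real M) * real N \<le> (l + \<epsilon>) * real N" by (rule mult_right_mono) simp
    moreover have "real (card (arc_visits (\<lambda>n. \<theta> + real n * \<alpha>) s l N))
        \<le> (l / \<eta> + 1) * (real N / real M + real q)"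
      by (rule card_arc_visits_le_mult[OF \<eta>(1) small l])
    moreover have "(l / \<eta> + 1) * (real N / real M + real q)
        = (l / \<eta> + 1) * (1 / real M) * real N + (l / \<eta> + 1) * real q"
      by (simp add: distrib_left)
    ultimately show ?thesis by linarith
  qed
  then show thesis by (rule that)
qed

text \<open>From \<open>n0\<close> on, a visit of \<open>y\<close> is a visit of the rotation to a
  slightly enlarged arc; the indices before \<open>n0\<close> only change the constant.\<close>

lemma arc_visits_perturbed_upper:
  fixes \<alpha> :: real
  assumes \<alpha>: "\<alpha> \<notin> \<rat>" and y: "(\<lambda>n. y n - (\<theta> + real n * \<alpha>)) \<longlonglongrightarrow> 0"
    and l: "l \<ge> 0" and \<epsilon>: "\<epsilon> > 0"
  obtains C where "\<And>N. real (card (arc_visits y s l N)) \<le> (l + \<epsilon>) * real N + C"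
proof -
  \<comment> \<open>Two thirds pay for enlarging the arc at both ends, one third for the loss in the
    bound for the rotation.\<close>
  define e where "e = \<epsilon> / 3"
  have "e > 0" using \<epsilon> by (simp add: e_def)
  then obtain n0 where n0: "\<And>n. n \<ge> n0 \<Longrightarrow> \<bar>y n - (\<theta> + real n * \<alpha>)\<bar> < e"
    using LIMSEQ_D[OF y, of e] by auto
  obtain C where C: "\<And>N. real (card (arc_visits (\<lambda>n. \<theta> + real n * \<alpha>) (s - e) (l + 2 * e) N))
      \<le> (l + 2 * e + e) * real N + C"
    using card_arc_visits_upper[OF \<alpha>, of "l + 2 * e" e] l \<open>e > 0\<close> by auto
  have "real (card (arc_visits y s l N)) \<le> (l + \<epsilon>) * real N + (C + real n0)" for N
  proof -
    let ?A = "arc_visits (\<lambda>n. \<theta> + real n * \<alpha>) (s - e) (l + 2 * e) N"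
    have "arc_visits y s l N \<subseteq> ?A \<union> {..<n0}"
    proof
      fix n assume "n \<in> arc_visits y s l N"
      then obtain z :: int where z: "n < N" "s \<le> y n - of_int z" "y n - of_int z < s + l"
        by (auto simp: arc_visits_def)
      have "s - e \<le> \<theta> + real n * \<alpha> - of_int z \<and> \<theta> + real n * \<alpha> - of_int z < (s - e) + (l + 2 * e)"
        if "n \<ge> n0"
        using n0[OF that] z unfolding abs_less_iff by linarith
      then show "n \<in> ?A \<union> {..<n0}" using z(1) unfolding arc_visits_def by fastforce
    qed
    then have "card (arc_visits y s l N) \<le> card (?A \<union> {..<n0})" by (intro card_mono) auto
    also have "\<dots> \<le> card ?A + n0" by (metis card_Un_le card_lessThan)
    finally have "real (card (arc_visits y s l N)) \<le> real (card ?A) + real n0"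
      by (simp flip: of_nat_add)
    then show ?thesis using C[of N] by (simp add: e_def algebra_simps)
  qed
  then show thesis by (rule that)
qed

lemma frac_less_iff_ex_int: "0 \<le> l \<Longrightarrow> l \<le> 1 \<Longrightarrow> frac v < l \<longleftrightarrow> (\<exists>z::int. 0 \<le> v - of_int z \<and> v - of_int z < l)"
  for v l :: real
proof safe
  assume "frac v < l"
  then show "\<exists>z::int. 0 \<le> v - of_int z \<and> v - of_int z < l"
    by (intro exI[of _ "\<lfloor>v\<rfloor>"]) (auto simp: frac_def)
next
  fix z :: int assume l: "l \<le> 1" and z: "0 \<le> v - of_int z" "v - of_int z < l"
  then have "\<lfloor>v\<rfloor> = z" by linarith
  then show "frac v < l" using z by (simp add: frac_def)
qed

text \<open>Upper bounds suffice: the complement of an arc is an arc.\<close>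

lemma equidistributed_mod_1:
  fixes \<alpha> :: real
  assumes \<alpha>: "\<alpha> \<notin> \<rat>" and y: "(\<lambda>n. y n - (\<theta> + real n * \<alpha>)) \<longlonglongrightarrow> 0" and l: "0 \<le> l" "l \<le> 1"
  shows "(\<lambda>N. real (card {n. 1 \<le> n \<and> n \<le> N \<and> frac (y n) < l}) / real N) \<longlonglongrightarrow> l"
proof (rule LIMSEQ_I)
  fix \<epsilon> :: real assume \<epsilon>: "\<epsilon> > 0"
  then have "\<epsilon> / 2 > 0" by simp
  from arc_visits_perturbed_upper[OF \<alpha> y l(1) this, where s = 0]
  obtain C where C: "\<And>N. real (card (arc_visits y 0 l N)) \<le> (l + \<epsilon>/2) * real N + C" by metis
  from arc_visits_perturbed_upper[OF \<alpha> y _ \<open>\<epsilon> / 2 > 0\<close>, where s = l and l = "1 - l"] l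
  obtain C' where C': "\<And>N. real (card (arc_visits y l (1 - l) N)) \<le> (1 - l + \<epsilon>/2) * real N + C'"
    by (metis diff_ge_0_iff_ge)
  \<comment> \<open>\<open>B\<close> absorbs both constants and the extra summand from counting up
    to \<open>Suc N\<close>: \<open>arc_visits\<close> uses \<open>n < N\<close>, whereas Benford's
    law counts from 1 to \<open>N\<close> inclusive.\<close>
  define B where "B = \<bar>C\<bar> + \<bar>C'\<bar> + 4 + \<epsilon>"
  have B: "C + 4 + \<epsilon> \<le> B" "C' + 4 + \<epsilon> \<le> B" by (auto simp: B_def)
  obtain N0 where N0: "real N0 > 2 * B / \<epsilon>" using reals_Archimedean2 by blast
  have "norm (real (card {n. 1 \<le> n \<and> n \<le> N \<and> frac (y n) < l}) / real N - l) < \<epsilon>" if "N \<ge> Suc N0" for N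
  proof -
    define A where "A = {n. 1 \<le> n \<and> n \<le> N \<and> frac (y n) < l}"
    define A' where "A' = {n. 1 \<le> n \<and> n \<le> N \<and> \<not> frac (y n) < l}"
    have fin: "finite A" "finite A'" by (auto simp: A_def A'_def)
    have "A \<subseteq> arc_visits y 0 l (Suc N)"
      using l by (auto simp: A_def arc_visits_def frac_less_iff_ex_int)
    then have "card A \<le> card (arc_visits y 0 l (Suc N))" by (intro card_mono) auto
    then have 1: "real (card A) \<le> (l + \<epsilon>/2) * real (Suc N) + C" using C[of "Suc N"] by linarith
    have "A' \<subseteq> arc_visits y l (1 - l) (Suc N)"
    proof
      fix n assume "n \<in> A'"
      then show "n \<in> arc_visits y l (1 - l) (Suc N)"
        using frac_lt_1[of "y n"]
        by (auto simp: A'_def arc_visits_def frac_def intro!: exI[of _ "\<lfloor>y n\<rfloor>"])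
    qed
    then have "card A' \<le> card (arc_visits y l (1 - l) (Suc N))" by (intro card_mono) auto
    then have 2: "real (card A') \<le> (1 - l + \<epsilon>/2) * real (Suc N) + C'" using C'[of "Suc N"] by linarith
    have "A \<union> A' = {1..N}" "A \<inter> A' = {}" by (auto simp: A_def A'_def)
    then have "card A + card A' = N" using card_Un_disjoint[OF fin] by simp
    then have 3: "real (card A) + real (card A') = real N" by (metis of_nat_add)
    have "real N > 2 * B / \<epsilon>" using N0 that by linarith
    then have NB: "\<epsilon> / 2 * real N > B" using \<epsilon> by (simp add: field_simps)
    have "real (card A) < (l + \<epsilon>) * real N" "real (card A) > (l - \<epsilon>) * real N"
      using 1 2 3 NB l \<epsilon> B unfolding of_nat_Suc distrib_left distrib_right left_diff_distrib mult_1_left mult_1_right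
      by linarith+
    moreover have "real N > 0" using that by simp
    ultimately have "real (card A) / real N < l + \<epsilon>" "real (card A) / real N > l - \<epsilon>"
      by (auto simp: pos_divide_less_eq pos_less_divide_eq)
    then show ?thesis unfolding A_def[symmetric] by (auto simp: abs_less_iff)
  qed
  then show "\<exists>no. \<forall>n\<ge>no. norm (real (card {i. 1 \<le> i \<and> i \<le> n \<and> frac (y i) < l}) / real n - l) < \<epsilon>"
    by blast
qed

section \<open>Benford's law for geometric growth\<close>

text \<open>The integer part of the logarithm is the exponent of \<open>b\<close>; uniqueness holds
  because the logarithm of a mantissa lies in [0, 1).\<close>

lemma mantissa_eq_powr_frac:
  assumes b: "b > 1" and u: "u > 0"
  shows "mantissa b u = real b powr frac (log b u)"
  unfolding mantissa_def
proof (rule the_equality)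
  have split: "log b u = of_int \<lfloor>log b u\<rfloor> + frac (log b u)" by (simp add: frac_def)
  have "u = real b powr (of_int \<lfloor>log b u\<rfloor> + frac (log b u))" using assms by (simp flip: split)
  then have "u = real b powr frac (log b u) * real b powi \<lfloor>log b u\<rfloor>"
    using b by (simp add: powr_add powr_real_of_int' mult.commute)
  moreover have "real b powr frac (log b u) < real b powr 1"
    using b by (intro powr_less_mono frac_lt_1) auto
  moreover have "1 \<le> real b powr frac (log b u)" using b by (intro ge_one_powr_ge_zero) auto
  ultimately show "1 \<le> real b powr frac (log b u) \<and> real b powr frac (log b u) < real b
      \<and> (\<exists>r::int. u = real b powr frac (log b u) * real b powi r)"
    using b by auto
next
  fix x assume "1 \<le> x \<and> x < real b \<and> (\<exists>r::int. u = x * real b powi r)"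
  then obtain r :: int where x: "1 \<le> x" "x < real b" and r: "u = x * real b powr of_int r"
    using b by (auto simp: powr_real_of_int')
  have "log b u = log b x + of_int r" using x b by (simp add: r log_mult)
  moreover have "0 \<le> log b x" "log b x < 1" using x b by (auto simp: log_less_one_cancel_iff)
  ultimately have "frac (log b u) = log b x" by (simp add: frac_unique_iff)
  then show "x = real b powr frac (log b u)" using x b by simp
qed

lemma mantissa_less_iff:
  assumes "b > 1" "u > 0" "t \<ge> 1"
  shows "mantissa b u < t \<longleftrightarrow> frac (log b u) < log b t"
  using assms by (simp add: mantissa_eq_powr_frac less_log_iff)

text \<open>Taking logarithms, log u(n) equals log L + n log q up to o(1), so equidistribution
  modulo 1 applies with slope \<open>log b q\<close>.\<close>

lemma benford_of_geometric_growth: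
  fixes u :: "nat \<Rightarrow> real"
  assumes b: "b > 1" and q: "q > 0" and irr: "log b q \<notin> \<rat>"
    and L: "L > 0" and lim: "(\<lambda>n. u n / q ^ n) \<longlonglongrightarrow> L"
  shows "benford b u"
proof -
  have "\<forall>\<^sub>F n in sequentially. u n / q ^ n > 0" using order_tendstoD(1)[OF lim L] .
  then have pos: "\<forall>\<^sub>F n in sequentially. u n > 0"
    by eventually_elim (use q in \<open>simp add: zero_less_divide_iff\<close>)
  then obtain n0 where n0: "\<And>n. n \<ge> n0 \<Longrightarrow> u n > 0" by (auto simp: eventually_sequentially)
  \<comment> \<open>The default \<open>q ^ n\<close> makes every term positive, so the logarithm
    laws apply to all \<open>n\<close>; only finitely many terms change.\<close>
  define v where "v n = (if u n > 0 then u n else q ^ n)" for n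
  have v: "v n > 0" for n using q by (simp add: v_def)
  have "\<forall>\<^sub>F n in sequentially. u n / q ^ n = v n / q ^ n"
    using pos by eventually_elim (simp add: v_def)
  then have "(\<lambda>n. v n / q ^ n) \<longlonglongrightarrow> L" using lim by (rule tendsto_cong[THEN iffD1])
  then have "(\<lambda>n. log b (v n / q ^ n) - log b L) \<longlonglongrightarrow> log b L - log b L"
    using L b by (intro tendsto_intros) auto
  moreover have "log b (v n / q ^ n) - log b L = log b (v n) - (log b L + real n * log b q)" for n
    using v[of n] q by (simp add: log_divide log_nat_power)
  ultimately have y: "(\<lambda>n. log b (v n) - (log b L + real n * log b q)) \<longlonglongrightarrow> 0" by simp
  have "(\<lambda>N. real (card {n. 1 \<le> n \<and> n \<le> N \<and> mantissa b (u n) < t}) / real N) \<longlonglongrightarrow> log b t"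
    if t: "1 \<le> t" "t < real b" for t
  proof -
    define F where "F N = {n. 1 \<le> n \<and> n \<le> N \<and> frac (log b (v n)) < log b t}" for N
    define G where "G N = {n. 1 \<le> n \<and> n \<le> N \<and> mantissa b (u n) < t}" for N
    have fin: "finite (F N)" "finite (G N)" for N by (auto simp: F_def G_def)
    have same: "n \<in> F N \<longleftrightarrow> n \<in> G N" if "n \<ge> n0" for n N
      using n0[OF that] b t by (auto simp: F_def G_def v_def mantissa_less_iff)
    \<comment> \<open>The two counts can differ only at indices below \<open>n0\<close>, which is
      negligible after division by \<open>N\<close>.\<close>
    have "\<bar>real (card (G N)) - real (card (F N))\<bar> \<le> real n0" for N
    proof -
      have "F N \<subseteq> G N \<union> {..<n0}" "G N \<subseteq> F N \<union> {..<n0}" using same by (auto simp: not_le[symmetric])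
      then have "card (F N) \<le> card (G N \<union> {..<n0})" "card (G N) \<le> card (F N \<union> {..<n0})"
        by (auto intro!: card_mono fin)
      then show ?thesis using card_Un_le[of "G N" "{..<n0}"] card_Un_le[of "F N" "{..<n0}"] by simp
    qed
    then have bound: "norm (real (card (G N)) / real N - real (card (F N)) / real N) \<le> real n0 / real N" for N
      by (simp add: abs_divide divide_right_mono flip: diff_divide_distrib)
    have "(\<lambda>N. real (card (G N)) / real N - real (card (F N)) / real N) \<longlonglongrightarrow> 0"
      by (rule Lim_null_comparison[OF always_eventually lim_const_over_n]) (use bound in blast)
    moreover have "(\<lambda>N. real (card (F N)) / real N) \<longlonglongrightarrow> log b t"
      unfolding F_def using b t by (intro equidistributed_mod_1[OF irr y]) auto
    ultimately have "(\<lambda>N. real (card (G N)) / real N) \<longlonglongrightarrow> 0 + log b t"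
      using tendsto_add by fastforce
    then show ?thesis by (simp add: G_def)
  qed
  then show ?thesis using pos by (simp add: benford_def)
qed

section \<open>Roots of dominant modulus\<close>

lemma poly_char_poly: "poly (char_poly k c) x = x ^ k - (\<Sum>j<k. c j * x ^ j)"
  by (simp add: char_poly_def poly_monom poly_sum)

lemma poly_char_poly_complex:
  "poly (map_poly complex_of_real (char_poly k c)) z = z ^ k - (\<Sum>j<k. of_real (c j) * z ^ j)"
proof -
  have "map_poly complex_of_real (char_poly k c) = monom 1 k - (\<Sum>j<k. monom (of_real (c j)) j)"
    by (rule poly_eqI) (simp add: char_poly_def coeff_map_poly coeff_sum if_distrib cong: if_cong)
  then show ?thesis by (simp add: poly_monom poly_sum)
qed

text \<open>Bezout's identity over the naturals, \<open>m * x = Gcd S * y + gcd m (Gcd S)\<close>,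
  avoids negative exponents and hence inverses of \<open>w\<close>.\<close>

lemma power_Gcd_eq_1:
  fixes w :: "'a :: monoid_mult"
  assumes "finite S" "\<And>n. n \<in> S \<Longrightarrow> w ^ n = 1"
  shows "w ^ Gcd S = 1"
  using assms
proof (induction S rule: finite_induct)
  case (insert m S)
  show ?case
  proof (cases "m = 0")
    case False
    then obtain x y where xy: "m * x = Gcd S * y + gcd m (Gcd S)" using bezout_nat by blast
    have "(w ^ m) ^ x = (w ^ Gcd S) ^ y * w ^ gcd m (Gcd S)"
      by (simp add: xy flip: power_mult power_add)
    then show ?thesis using insert by simp
  qed (use insert in simp)
qed simp

text \<open>Equality in the triangle inequality: the unit complex numbers \<open>w ^ j\<close> with \<open>a j > 0\<close> all
  coincide with their convex combination \<open>w ^ k\<close>.\<close>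

lemma unit_power_eq_of_convex_combination:
  fixes w :: complex and a :: "nat \<Rightarrow> real"
  assumes w: "cmod w = 1" and a: "\<And>j. j < k \<Longrightarrow> a j \<ge> 0"
    and eq: "of_real (\<Sum>j<k. a j) * w ^ k = (\<Sum>j<k. of_real (a j) * w ^ j)"
    and j: "j < k" "a j > 0"
  shows "w ^ j = w ^ k"
proof -
  have w0: "w \<noteq> 0" using w by auto
  define v where "v i = w ^ i / w ^ k" for i
  have v: "cmod (v i) = 1" for i using w by (simp add: v_def norm_divide norm_power)
  have "(\<Sum>i<k. of_real (a i) * v i) = (\<Sum>i<k. of_real (a i) * w ^ i) / w ^ k"
    by (simp add: v_def sum_divide_distrib)
  also have "\<dots> = of_real (\<Sum>i<k. a i)" using w0 by (simp flip: eq)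
  finally have "Re (\<Sum>i<k. of_real (a i) * v i) = Re (of_real (\<Sum>i<k. a i))" by simp
  then have "(\<Sum>i<k. a i * (1 - Re (v i))) = 0" by (simp add: right_diff_distrib sum_subtractf)
  moreover have "a i * (1 - Re (v i)) \<ge> 0" if "i < k" for i
    using a[OF that] complex_Re_le_cmod[of "v i"] v[of i] by simp
  ultimately have "a j * (1 - Re (v j)) = 0"
    using j sum_nonneg_eq_0_iff[of "{..<k}" "\<lambda>i. a i * (1 - Re (v i))"] by blast
  then have Re: "Re (v j) = 1" using j by simp
  then have "Im (v j) = 0" using v[of j] by (simp add: cmod_def)
  then have "v j = 1" using Re by (simp add: complex_eq_iff)
  then show ?thesis using w0 by (simp add: v_def)
qed

text \<open>For a root \<rho> w with |w| = 1, rigidity of convex combinations makes all powers of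
  \<open>w\<close> with active coefficients equal. Conversely, \<open>w ^ g = 1\<close> turns every
  active power into 1, and the equation for \<rho> w becomes the one for \<rho>.\<close>

lemma roots_of_dominant_modulus:
  assumes k: "k \<ge> 1" and c0: "c 0 > 0" and c: "\<And>j. j < k \<Longrightarrow> c j \<ge> 0"
    and \<rho>: "\<rho> > 0" "poly (char_poly k c) \<rho> = 0"
  defines "g \<equiv> Gcd (coeff_support k c \<union> {k})"
  shows "{z \<in> complex_roots (char_poly k c). cmod z = \<rho>} = (\<lambda>w. of_real \<rho> * w) ` {w. w ^ g = 1}"
proof -
  define a where "a j = c j * \<rho> ^ j" for j
  have a_sum: "(\<Sum>j<k. a j) = \<rho> ^ k" using \<rho>(2) by (simp add: poly_char_poly a_def)
  have root_iff: "of_real \<rho> * w \<in> complex_roots (char_poly k c) \<longleftrightarrow>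
      of_real (\<Sum>j<k. a j) * w ^ k = (\<Sum>j<k. of_real (a j) * w ^ j)" for w
    unfolding a_sum by (simp add: complex_roots_def poly_char_poly_complex a_def power_mult_distrib mult.assoc)
  have fin: "finite (coeff_support k c \<union> {k})"
    by (rule finite_subset[of _ "{..k}"]) (auto simp: coeff_support_def)
  have "w ^ g = 1" if w: "cmod w = 1" "of_real \<rho> * w \<in> complex_roots (char_poly k c)" for w
  proof -
    have "w ^ j = w ^ k" if "j < k" "c j > 0" for j
      using w that \<rho> c unfolding root_iff
      by (intro unit_power_eq_of_convex_combination[of w k a j]) (auto simp: a_def)
    \<comment> \<open>Since \<open>c 0 > 0\<close>, the case \<open>j = 0\<close> yields
      \<open>w ^ k = 1\<close>, which fixes the common value.\<close>
    from this this[of 0] have "w ^ j = 1" if "j \<in> coeff_support k c \<union> {k}" for j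
      using that k c0 by (auto simp: coeff_support_def)
    then show ?thesis unfolding g_def by (intro power_Gcd_eq_1 fin)
  qed
  moreover have "cmod w = 1 \<and> of_real \<rho> * w \<in> complex_roots (char_poly k c)" if w: "w ^ g = 1" for w
  proof
    have "g dvd k" by (simp add: g_def)
    then have wk: "w ^ k = 1" using w by (auto simp: power_mult elim!: dvdE)
    then have "cmod w ^ k = 1" by (simp flip: norm_power)
    then show "cmod w = 1" using k power_eq_imp_eq_base[of "cmod w" k 1] by simp
    have eq: "of_real (a j) * w ^ j = of_real (a j)" if "j < k" for j
    proof (cases "j = 0 \<or> c j = 0")
      case False
      then have "j \<in> coeff_support k c \<union> {k}" using that c[of j] by (auto simp: coeff_support_def)
      then have "g dvd j" unfolding g_def by (rule Gcd_dvd)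
      then show ?thesis using w by (auto simp: power_mult elim!: dvdE)
    qed (auto simp: a_def)
    show "of_real \<rho> * w \<in> complex_roots (char_poly k c)"
      unfolding root_iff of_real_sum wk mult_1_right by (rule sum.cong[OF refl]) (simp add: eq)
  qed
  moreover have norm_iff: "cmod (of_real \<rho> * w) = \<rho> \<longleftrightarrow> cmod w = 1" for w
    using \<rho> by (simp add: norm_mult)
  ultimately have iff: "of_real \<rho> * w \<in> complex_roots (char_poly k c) \<and> cmod (of_real \<rho> * w) = \<rho> \<longleftrightarrow> w ^ g = 1" for w
    unfolding norm_iff by blast
  show ?thesis
  proof (intro equalityI subsetI)
    fix z assume z: "z \<in> {z \<in> complex_roots (char_poly k c). cmod z = \<rho>}"
    have "z = of_real \<rho> * (z / of_real \<rho>)" using \<rho> by simp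
    moreover from this z have "(z / of_real \<rho>) ^ g = 1" by (subst iff[symmetric]) auto
    ultimately show "z \<in> (\<lambda>w. of_real \<rho> * w) ` {w. w ^ g = 1}" by blast
  qed (use iff in blast)
qed

lemma num_roots_of_dominant_modulus:
  assumes "k \<ge> 1" "c 0 > 0" "\<And>j. j < k \<Longrightarrow> c j \<ge> 0" "\<rho> > 0" "poly (char_poly k c) \<rho> = 0"
  shows "num_roots_of_modulus (char_poly k c) \<rho> = Gcd (coeff_support k c \<union> {k})"
proof -
  have "Gcd (coeff_support k c \<union> {k}) > 0" using assms(1) by (auto intro!: Nat.gr0I)
  moreover have "{z \<in> complex_roots (char_poly k c). cmod z = \<rho>}
      = (\<lambda>w. of_real \<rho> * w) ` {w. w ^ Gcd (coeff_support k c \<union> {k}) = 1}"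
    by (rule roots_of_dominant_modulus[OF assms])
  ultimately show ?thesis
    using assms(4) unfolding num_roots_of_modulus_def
    by (simp only:) (subst card_image, auto simp: inj_on_def card_roots_unity_eq)
qed

section \<open>Residue subsequences\<close>

text \<open>This is division with remainder by \<open>h\<close>. The start \<open>l\<close> is a
  parameter because the theorem needs two versions: all indices from 1 on, and
  \<open>n \<ge> 1\<close>, which covers exactly the indices from \<open>h\<close> on.\<close>

lemma is_union_of_residue_subseqs:
  assumes h: "h > 0" and E: "\<And>m n. m < h \<Longrightarrow> n \<in> E m \<longleftrightarrow> l \<le> m + h * n"
  shows "is_union_of_subseqs a {l..} {..<h} E (\<lambda>m n. m + h * n)"
  unfolding is_union_of_subseqs_def
proof (intro conjI ballI)
  show "strict_mono_on (E m) (\<lambda>n. m + h * n)" for m using h by (auto simp: strict_mono_on_def)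
  show "disjoint_family_on (\<lambda>m. (\<lambda>n. m + h * n) ` E m) {..<h}"
  proof (unfold disjoint_family_on_def, safe)
    fix m m' n n' assume m: "m < h" "m' < h" "m \<noteq> m'" and eq: "m + h * n = m' + h * n'"
    have "(m + h * n) mod h = (m' + h * n') mod h" by (simp only: eq)
    then show "m + h * n \<in> {}" using m by simp
  qed
  show "(\<lambda>i. (i, a i)) ` {l..} = (\<Union>m\<in>{..<h}. (\<lambda>n. (m + h * n, a (m + h * n))) ` E m)"
  proof (intro equalityI subsetI)
    fix p assume "p \<in> (\<lambda>i. (i, a i)) ` {l..}"
    then obtain i where i: "i \<ge> l" "p = (i, a i)" by auto
    have eq: "i = i mod h + h * (i div h)" by simp
    then have "i div h \<in> E (i mod h)" using i E h by simp
    then show "p \<in> (\<Union>m\<in>{..<h}. (\<lambda>n. (m + h * n, a (m + h * n))) ` E m)"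
      using eq h unfolding i(2) by (intro UN_I[of "i mod h"] image_eqI[of _ _ "i div h"]) auto
  qed (use E in auto)
qed

lemma sum_over_multiples:
  fixes f :: "nat \<Rightarrow> 'a :: comm_monoid_add"
  assumes "h > 0" and "\<And>j. j < h * K \<Longrightarrow> \<not> h dvd j \<Longrightarrow> f j = 0"
  shows "(\<Sum>j<h * K. f j) = (\<Sum>i<K. f (h * i))"
proof -
  have "f j = 0" if "j \<in> {..<h * K} - (\<lambda>i. h * i) ` {..<K}" for j
    using that assms by (cases "h dvd j") (auto elim!: dvdE)
  then have "(\<Sum>j<h * K. f j) = (\<Sum>j\<in>(\<lambda>i. h * i) ` {..<K}. f j)"
    using assms(1) by (intro sum.mono_neutral_right) auto
  also have "\<dots> = (\<Sum>i<K. f (h * i))"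
    using assms(1) by (subst sum.reindex) (auto simp: inj_on_def)
  finally show ?thesis .
qed

text \<open>Along a residue class modulo \<open>h\<close>, the sequence scaled by powers of \<open>\<rho>\<close> solves an
  aperiodic convex recurrence of order \<open>k / h\<close>. Starting at \<open>m \<ge> 1\<close>, its initial values are
  the \<open>a j\<close> with \<open>j\<close> in the class and \<open>m \<le> j < m + k\<close>.\<close>

lemma residue_subsequence_limit:
  assumes k: "k \<ge> 1" and c0: "c 0 > 0" and c: "\<And>j. j < k \<Longrightarrow> c j \<ge> 0"
    and \<rho>: "\<rho> > 0" "poly (char_poly k c) \<rho> = 0"
    and h: "h = Gcd (coeff_support k c \<union> {k})"
    and a: "satisfies_recurrence k c a" and K: "k = h * K" and m: "m \<ge> 1"
    and nonneg: "\<And>i. i < K \<Longrightarrow> a (m + h * i) \<ge> 0"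
  shows "(\<exists>i<K. a (m + h * i) > 0) \<Longrightarrow> \<exists>L>0. (\<lambda>n. a (m + h * n) / \<rho> ^ (h * n)) \<longlonglongrightarrow> L"
    and "(\<forall>i<K. a (m + h * i) = 0) \<Longrightarrow> a (m + h * n) = 0"
proof -
  have "h > 0" "K > 0" using k K by (auto intro!: Nat.gr0I)
  have c_zero: "c j = 0" if "j < k" "\<not> h dvd j" for j
  proof (rule ccontr)
    assume "c j \<noteq> 0"
    then have "j \<in> coeff_support k c"
      using that c[of j] by (cases "j = 0") (auto simp: coeff_support_def)
    then show False using that(2) unfolding h by (simp only: Gcd_dvd Un_iff simp_thms)
  qed
  \<comment> \<open>These are the coefficients of the recurrence after scaling; they sum to 1
    because \<rho> is a root and the coefficients off the multiples of \<open>h\<close>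
    vanish.\<close>
  define d where "d i = c (h * i) * \<rho> ^ (h * i) / \<rho> ^ k" for i
  define x where "x n = a (m + h * n) / \<rho> ^ (h * n)" for n
  have less: "h * i < k" if "i < K" for i using that \<open>h > 0\<close> by (simp add: K)
  interpret convex_recurrence K d
  proof
    show "K \<ge> 1" using \<open>K > 0\<close> by simp
    show "d 0 > 0" using c0 \<rho> by (simp add: d_def)
    show "d i \<ge> 0" if "i < K" for i using c[OF less[OF that]] \<rho> by (simp add: d_def)
    have "\<rho> ^ k = (\<Sum>j<k. c j * \<rho> ^ j)" using \<rho>(2) by (simp add: poly_char_poly)
    also have "\<dots> = (\<Sum>i<K. c (h * i) * \<rho> ^ (h * i))"
      unfolding K using \<open>h > 0\<close> c_zero K by (intro sum_over_multiples) auto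
    finally show "(\<Sum>i<K. d i) = 1" using \<rho>(1) by (simp add: d_def flip: sum_divide_distrib) (metis less_irrefl zero_less_power)
  next
    fix e assume e: "e dvd K" "\<And>i. i < K \<Longrightarrow> d i > 0 \<Longrightarrow> e dvd i"
    \<comment> \<open>A common divisor \<open>e\<close> in the reduced recurrence would make
      \<open>h * e\<close> a common divisor in the original one, hence a divisor of
      \<open>h\<close>.\<close>
    have "h * e dvd j" if j: "j \<in> coeff_support k c" for j
    proof -
      have "h dvd j" using j unfolding h by (intro Gcd_dvd) simp
      then obtain i where i: "j = h * i" by (rule dvdE)
      have "i < K" "d i > 0" using j \<rho> \<open>h > 0\<close> by (auto simp: i coeff_support_def d_def K)
      then show ?thesis using e(2) by (simp add: i)
    qed
    moreover have "h * e dvd k" using e(1) by (simp add: K)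
    ultimately have "h * e dvd Gcd (coeff_support k c \<union> {k})"
      by (intro Gcd_greatest) auto
    then have "h * e dvd h" unfolding h[symmetric] .
    then show "e = 1" using \<open>h > 0\<close> by simp
  qed
  have "x (n + K) = (\<Sum>i<K. d i * x (n + i))" for n
  proof -
    have "a (m + h * (n + K)) = a ((m + h * n) + k)"
      unfolding K by (rule arg_cong[of _ _ a]) (simp add: algebra_simps)
    \<comment> \<open>The recurrence is available only from index 1 on, which
      \<open>m \<ge> 1\<close> guarantees.\<close>
    also have "\<dots> = (\<Sum>j<k. c j * a ((m + h * n) + j))"
      using a m unfolding satisfies_recurrence_def by simp
    also have "\<dots> = (\<Sum>i<K. c (h * i) * a ((m + h * n) + h * i))"
      unfolding K using \<open>h > 0\<close> c_zero K by (intro sum_over_multiples) auto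
    finally have "x (n + K) = (\<Sum>i<K. c (h * i) * a ((m + h * n) + h * i)) / \<rho> ^ (h * (n + K))"
      by (simp add: x_def)
    also have "\<dots> = (\<Sum>i<K. d i * x (n + i))"
      unfolding sum_divide_distrib
    proof (rule sum.cong[OF refl])
      fix i
      show "c (h * i) * a ((m + h * n) + h * i) / \<rho> ^ (h * (n + K)) = d i * x (n + i)"
        using \<rho>(1) by (simp add: d_def x_def K distrib_left power_add add.assoc)
    qed
    finally show ?thesis .
  qed
  then have x: "solution x" by (simp add: solution_def)
  have x0: "x i \<ge> 0" if "i < K" for i using nonneg[OF that] \<rho>(1) by (simp add: x_def)
  {
    assume "\<exists>i<K. a (m + h * i) > 0"
    then obtain i where "i < K" "x i > 0" using \<rho>(1) by (auto simp: x_def)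
    then show "\<exists>L>0. (\<lambda>n. a (m + h * n) / \<rho> ^ (h * n)) \<longlonglongrightarrow> L"
      using solution_tendsto_positive[OF x x0] by (simp add: x_def)
  next
    assume "\<forall>i<K. a (m + h * i) = 0"
    then have "x i = 0" if "i < K" for i using that by (simp add: x_def)
    \<comment> \<open>A vanishing initial window gives the lower bound 0 for both \<open>x\<close>
      and its negation.\<close>
    then have "0 \<le> x n" "0 \<le> - x n"
      using solution_lower_bound[OF x, of 0] solution_lower_bound[OF solution_uminus[OF x], of 0]
      by auto
    then show "a (m + h * n) = 0" using \<rho>(1) by (simp add: x_def)
  }
qed

text \<open>Within the indices from 1 on, the class of 0 begins at \<open>h\<close> rather than at
  0.\<close>

lemma residue_part_initial_segment:
  assumes "m < h" "h > 0"
  shows "residue_part {1..h * K} h m = (\<lambda>i. (if m = 0 then h else m) + h * i) ` {..<K}" (is "_ = ?f ` _")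
proof (intro equalityI subsetI)
  fix j assume "j \<in> residue_part {1..h * K} h m"
  then have j: "1 \<le> j" "j \<le> h * K" "j mod h = m" using assms by (auto simp: residue_part_def)
  define q where "q = j div h"
  have eq: "j = m + h * q" using j(3) by (metis mod_mult_div_eq q_def)
  show "j \<in> ?f ` {..<K}"
  proof (cases "m = 0")
    case True
    then have "q \<le> K" "q \<ge> 1" using j eq assms by auto
    then show ?thesis using True eq by (intro image_eqI[of _ _ "q - 1"]) (auto simp: algebra_simps)
  next
    case False
    then have "h * q < h * K" using j eq by linarith
    then show ?thesis using False eq by (intro image_eqI[of _ _ q]) auto
  qed
next
  fix j assume "j \<in> ?f ` {..<K}"
  then obtain i where i: "i < K" "j = ?f i" by auto
  then have "h * Suc i \<le> h * K" by (intro mult_left_mono) auto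
  then show "j \<in> residue_part {1..h * K} h m" using assms i(2) by (auto simp: residue_part_def)
qed

text \<open>One step of a residue subsequence advances the index by \<open>h\<close>, so its growth
  factor is \<open>\<rho> ^ h\<close>; the limit is therefore taken after division by
  \<open>\<rho> ^ (h * n)\<close>.\<close>

theorem mainTheorem2:
  fixes k h :: nat and c :: "nat \<Rightarrow> real" and \<rho> :: real
  assumes "k \<ge> 1"
    and "c 0 > 0"
    and "\<And>j. 1 \<le> j \<Longrightarrow> j < k \<Longrightarrow> c j \<ge> 0"
    and "is_dominant_root (char_poly k c) \<rho>"
    and "h = num_roots_of_modulus (char_poly k c) \<rho>"
    and "h > 1"
  shows "h = Gcd (coeff_support k c \<union> {k}) \<and>
    (\<forall>a :: nat \<Rightarrow> real.
      satisfies_recurrence k c a \<and> (\<forall>j. 1 \<le> j \<and> j \<le> k \<longrightarrow> a j \<ge> 0) \<longrightarrow>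
        is_union_of_subseqs a {1..} {..<h} (\<lambda>m. {n. 1 \<le> m + h * n}) (\<lambda>m n. m + h * n) \<and>
        is_union_of_subseqs a {h..} {..<h} (\<lambda>m. {1..}) (\<lambda>m n. m + h * n) \<and>
        (\<forall>m<h.
          ({j \<in> residue_part {1..k} h m. a j > 0} \<noteq> {} \<longrightarrow>
             (\<exists>L>0. (\<lambda>n. a (m + h * n) / \<rho> ^ (h * n)) \<longlonglongrightarrow> L) \<and>
             (\<forall>b::nat. b > 2 \<and> log (real b) \<rho> \<notin> \<rat> \<longrightarrow> benford b (\<lambda>n. a (m + h * n)))) \<and>
          ({j \<in> residue_part {1..k} h m. a j > 0} = {} \<longrightarrow>
             (\<forall>n\<ge>1. a (m + h * n) = 0))))"
proof -
  have \<rho>: "\<rho> > 0" "poly (char_poly k c) \<rho> = 0" using assms(4) by (auto simp: is_dominant_root_def)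
  have c: "c j \<ge> 0" if "j < k" for j using assms(2) assms(3)[of j] that by (cases "j = 0") auto
  have h: "h = Gcd (coeff_support k c \<union> {k})"
    unfolding assms(5) using num_roots_of_dominant_modulus[where c = c, OF assms(1,2) c \<rho>] .
  have "h dvd k" by (simp add: h)
  then obtain K where K: "k = h * K" by (rule dvdE)
  have h0: "h > 0" using assms(6) by simp
  have unions: "is_union_of_subseqs a {1..} {..<h} (\<lambda>m. {n. 1 \<le> m + h * n}) (\<lambda>m n. m + h * n)"
    "is_union_of_subseqs a {h..} {..<h} (\<lambda>m. {1..}) (\<lambda>m n. m + h * n)" for a
  proof -
    have "n \<in> {1..} \<longleftrightarrow> h \<le> m + h * n" if "m < h" for m n
      using that by (cases n) auto
    then show "is_union_of_subseqs a {h..} {..<h} (\<lambda>m. {1..}) (\<lambda>m n. m + h * n)"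
      by (rule is_union_of_residue_subseqs[OF h0])
  qed (rule is_union_of_residue_subseqs[OF h0], simp)
  have alternative: "({j \<in> residue_part {1..k} h m. a j > 0} \<noteq> {} \<longrightarrow>
        (\<exists>L>0. (\<lambda>n. a (m + h * n) / \<rho> ^ (h * n)) \<longlonglongrightarrow> L)) \<and>
      ({j \<in> residue_part {1..k} h m. a j > 0} = {} \<longrightarrow> (\<forall>n\<ge>1. a (m + h * n) = 0))"
    if a: "satisfies_recurrence k c a" "\<And>j. 1 \<le> j \<Longrightarrow> j \<le> k \<Longrightarrow> a j \<ge> 0" and m: "m < h" for a m
  proof -
    \<comment> \<open>\<open>m'\<close> is the first positive index in the class of
      \<open>m\<close>, so the recurrence is valid from there.\<close>
    define m' where "m' = (if m = 0 then h else m)"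
    have m': "m' \<ge> 1" using h0 by (simp add: m'_def)
    have part: "residue_part {1..k} h m = (\<lambda>i. m' + h * i) ` {..<K}"
      unfolding K m'_def by (rule residue_part_initial_segment[OF m h0])
    then have nonneg: "a (m' + h * i) \<ge> 0" if "i < K" for i
      using a(2) that by (auto simp: residue_part_def)
    note sub = residue_subsequence_limit[where c = c, OF assms(1,2) c \<rho> h a(1) K m' nonneg]
    show ?thesis
    proof (intro conjI impI)
      assume "{j \<in> residue_part {1..k} h m. a j > 0} \<noteq> {}"
      then have "\<exists>i<K. a (m' + h * i) > 0" unfolding part by auto
      then obtain L where L: "L > 0" "(\<lambda>n. a (m' + h * n) / \<rho> ^ (h * n)) \<longlonglongrightarrow> L"
        using sub(1) by blast
      show "\<exists>L>0. (\<lambda>n. a (m + h * n) / \<rho> ^ (h * n)) \<longlonglongrightarrow> L"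
      proof (cases "m = 0")
        case True
        \<comment> \<open>For \<open>m = 0\<close> the sequence started at \<open>m' = h\<close> is
          shifted by one step, which divides the limit by \<open>\<rho> ^ h\<close>.\<close>
        have "(\<lambda>n. a (m' + h * n) / \<rho> ^ (h * n) / \<rho> ^ h) \<longlonglongrightarrow> L / \<rho> ^ h"
          using L(2) \<rho>(1) by (intro tendsto_divide) auto
        then have "(\<lambda>n. a (m + h * Suc n) / \<rho> ^ (h * Suc n)) \<longlonglongrightarrow> L / \<rho> ^ h"
          by (simp add: True m'_def power_add mult.commute)
        then have "(\<lambda>n. a (m + h * n) / \<rho> ^ (h * n)) \<longlonglongrightarrow> L / \<rho> ^ h" by (rule LIMSEQ_imp_Suc)
        then show ?thesis using L(1) \<rho>(1) by (intro exI[of _ "L / \<rho> ^ h"]) simp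
      qed (use L in \<open>auto simp: m'_def\<close>)
    next
      assume "{j \<in> residue_part {1..k} h m. a j > 0} = {}"
      then have "\<forall>i<K. a (m' + h * i) = 0" using nonneg unfolding part by force
      then have zero: "a (m' + h * n) = 0" for n using sub(2) by blast
      show "\<forall>n\<ge>1. a (m + h * n) = 0"
      proof (intro allI impI)
        fix n :: nat assume "n \<ge> 1"
        then show "a (m + h * n) = 0"
          \<comment> \<open>For \<open>m = 0\<close> the term at \<open>n\<close> is the term at
            \<open>n - 1\<close> of the sequence started at \<open>h\<close>.\<close>
          using zero[of n] zero[of "n - 1"] by (cases n) (auto simp: m'_def split: if_splits)
      qed
    qed
  qed
  have benford: "benford b (\<lambda>n. a (m + h * n))"
    if "L > 0" "(\<lambda>n. a (m + h * n) / \<rho> ^ (h * n)) \<longlonglongrightarrow> L" "b > 2" "log b \<rho> \<notin> \<rat>"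
    for a m b and L :: real
  proof (rule benford_of_geometric_growth)
    show "(\<lambda>n. a (m + h * n) / (\<rho> ^ h) ^ n) \<longlonglongrightarrow> L" using that by (simp add: power_mult)
    \<comment> \<open>The logarithm is \<open>h\<close> times that of \<rho>, and multiplication by
      the nonzero integer \<open>h\<close> preserves irrationality.\<close>
    show "log b (\<rho> ^ h) \<notin> \<rat>"
    proof
      assume "log b (\<rho> ^ h) \<in> \<rat>"
      then have "(real h * log b \<rho>) / real h \<in> \<rat>" using \<rho>(1) by (intro Rats_divide) (auto simp: log_nat_power)
      then show False using that(4) h0 by simp
    qed
  qed (use that \<rho> in auto)
  show ?thesis
    using h unions alternative benford by (intro conjI allI impI) blast+
qed

end
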